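(* For every even integer $n\ge6$, the antiprism graph on $n$ vertices is not B-factorizable. (For $n=6$ this is the graph of the octahedron.)
   Context: The antiprism graph on $n$ vertices has vertex set $V=\mathbb Z/n\mathbb Z$ and edge set $\{\{i,i+1\}: i\in\mathbb Z/n\}\cup\{\{i,i+2\}: i\in\mathbb Z/n\}$; for $n\ge 6$ it is 4-regular. Let $V$ be a finite set with $|V|$ even. $K=\binom{V}{2}$ is the set of 2-element subsets of $V$. An equal partition of $V$ is an unordered pair $\{H,A\}$ of disjoint subsets with $H\cup A=V$ and $|H|=|A|=|V|/2$; $C=C(V)$ is the set of equal partitions. For $c=\{H,A\}\in C$, $B_c$ is the complete bipartite graph with parts $H$ and $A$. Vectors live in $\mathbb N^{K\cup C}$ with $\mathbb N=\{0,1,2,\dots\}$; $v|_K$ denotes the restriction to coordinates in $K$. For $E\subseteq K$, $\chi_E\in\{0,1\}^K$ is its indicator vector. For $E\subseteq K$ and $c\in C$, $\chi_{E,c}\in\mathbb N^{K\cup C}$ has $K$-components $\chi_E$ and $C$-components equal to the indicator of $c$. $PM(V)=\{\chi_{q,c}: c\in C,\ q\text{ a perfect matching of }B_c\}$. For $\mathcal M\subseteq\mathbb N^{K\cup C}$, $\mathbf N(\mathcal M)$ is the set of finite nonnegative integer combinations of elements of $\mathcal M$, and $\overline{\mathbf N}(\mathcal M)=\{v\in\mathbb N^{K\cup C}: kv\in\mathbf N(\mathcal M)\text{ for some integer }k\ge1\}$. A regular graph $G=(V,E)$ is B-factorizable if every $v\in\overline{\mathbf N}(PM(V))$ with $v|_K=\chi_E$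 belongs to $\mathbf N(PM(V))$. *)

theory Defs
  imports Main
begin

text \<open>Coordinates of vectors in N^(K \<union> C): Inl e for e \<in> K, Inr c for c \<in> C.\<close>
type_synonym 'a coord = "'a set + 'a set set"
type_synonym 'a vec = "'a coord \<Rightarrow> nat"

definition Kset :: "'a set \<Rightarrow> 'a set set" where
  "Kset V = {e. e \<subseteq> V \<and> card e = 2}"

definition Cset :: "'a set \<Rightarrow> 'a set set set" where
  "Cset V = {{H, A} | H A. H \<inter> A = {} \<and> H \<union> A = V \<and>
                           card H = card V div 2 \<and> card A = card V div 2}"

definition coords :: "'a set \<Rightarrow> 'a coord set" where
  "coords V = Inl ` Kset V \<union> Inr ` Cset V"

definition vecs :: "'a set \<Rightarrow> 'a vec set" where
  "vecs V = {v. \<forall>x. x \<notin> coords V \<longrightarrow> v x = 0}"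

definition bip_edges :: "'a set \<Rightarrow> 'a set \<Rightarrow> 'a set set" where
  "bip_edges H A = {{h, a} | h a. h \<in> H \<and> a \<in> A}"

definition perfect_matching_Bc :: "'a set \<Rightarrow> 'a set set \<Rightarrow> 'a set set \<Rightarrow> bool" where
  "perfect_matching_Bc V c q \<longleftrightarrow>
     (\<exists>H A. c = {H, A} \<and> q \<subseteq> bip_edges H A) \<and>
     (\<forall>x\<in>V. \<exists>!e. e \<in> q \<and> x \<in> e)"

definition chiEc :: "'a set set \<Rightarrow> 'a set set \<Rightarrow> 'a vec" where
  "chiEc E c = (\<lambda>x. case x of Inl e \<Rightarrow> (if e \<in> E then 1 else 0)
                           | Inr d \<Rightarrow> (if d = c then 1 else 0))"

definition PM :: "'a set \<Rightarrow> 'a vec set" where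
  "PM V = {chiEc q c | q c. c \<in> Cset V \<and> perfect_matching_Bc V c q}"

definition Ncomb :: "'a vec set \<Rightarrow> 'a vec set" where
  "Ncomb M = {v. \<exists>F a. finite F \<and> F \<subseteq> M \<and>
                     v = (\<lambda>x. \<Sum>m\<in>F. a m * m x)}"

definition Nbar :: "'a set \<Rightarrow> 'a vec set \<Rightarrow> 'a vec set" where
  "Nbar V M = {v \<in> vecs V. \<exists>k::nat. k \<ge> 1 \<and> (\<lambda>x. k * v x) \<in> Ncomb M}"

definition restrK_eq :: "'a set \<Rightarrow> 'a vec \<Rightarrow> 'a set set \<Rightarrow> bool" where
  "restrK_eq V v E \<longleftrightarrow> (\<forall>e\<in>Kset V. v (Inl e) = (if e \<in> E then 1 else 0))"

definition B_factorizable :: "'a set \<Rightarrow> 'a set set \<Rightarrow> bool" where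
  "B_factorizable V E \<longleftrightarrow>
     (\<forall>v \<in> Nbar V (PM V). restrK_eq V v E \<longrightarrow> v \<in> Ncomb (PM V))"

definition antiprism_edges :: "nat \<Rightarrow> nat set set" where
  "antiprism_edges n = {{i, (i + 1) mod n} | i. i < n} \<union> {{i, (i + 2) mod n} | i. i < n}"

end

theory Submission
  imports Defs
begin

text \<open>We choose four equal partitions and, for each of them, two perfect matchings of its complete
  bipartite graph such that the eight matchings together cover every edge of the antiprism exactly
  twice. Then \<open>\<chi>\<^sub>E\<close> together with the four partitions is half of a sum of elements of \<open>PM(V)\<close>. It is
  not itself such a sum, since that would require four pairwise disjoint matchings inside the
  antiprism, one for each partition, and this already fails around a few consecutive vertices.

  Such data exist for \<open>n = 6\<close> and \<open>n = 8\<close> and can be chosen such that a block of four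
  vertices can be inserted arbitrarily often away from the obstruction; this gives all even
  \<open>n \<ge> 6\<close>.\<close>

section \<open>Bisections and matchings\<close>

definition bisection :: "'a set \<Rightarrow> ('a \<Rightarrow> bool) \<Rightarrow> 'a set set" where
  "bisection V w = {{x \<in> V. w x}, {x \<in> V. \<not> w x}}"

definition involution_edges :: "'a set \<Rightarrow> ('a \<Rightarrow> 'a) \<Rightarrow> 'a set set" where
  "involution_edges V f = {{x, f x} | x. x \<in> V}"

text \<open>The pair is unordered, so \<open>w\<close> and its negation give the same bisection;
  what survives is only which vertices share a side. This serves to tell bisections apart.\<close>

lemma bisection_eqD:
  assumes "bisection V w = bisection V w'" "x \<in> V" "y \<in> V"
  shows "(w x = w y) = (w' x = w' y)"
proof -
  have "{x \<in> V. w x} = {x \<in> V. w' x} \<or> {x \<in> V. w x} = {x \<in> V. \<not> w' x}"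
    using assms(1) unfolding bisection_def doubleton_eq_iff by blast
  then show ?thesis
    using assms(2,3) by blast
qed

lemma doubleton_in_involution_edges:
  assumes "\<And>x. x \<in> V \<Longrightarrow> f (f x) = x" "x \<in> V"
  shows "{x, y} \<in> involution_edges V f \<longleftrightarrow> f x = y"
  using assms unfolding involution_edges_def by (auto simp: doubleton_eq_iff)

text \<open>An involution that always changes sides has no fixed points, so its orbits are disjoint
  pairs crossing the cut.\<close>

lemma perfect_matching_involution_edges:
  assumes "\<And>x. x \<in> V \<Longrightarrow> f x \<in> V" "\<And>x. x \<in> V \<Longrightarrow> f (f x) = x"
    and "\<And>x. x \<in> V \<Longrightarrow> w (f x) \<noteq> w x"
  shows "perfect_matching_Bc V (bisection V w) (involution_edges V f)"
proof -
  have "involution_edges V f \<subseteq> bip_edges {x \<in> V. w x} {x \<in> V. \<not> w x}"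
  proof
    fix e assume "e \<in> involution_edges V f"
    then obtain x where x: "x \<in> V" "e = {x, f x}"
      unfolding involution_edges_def by blast
    have e': "e = {f x, x}"
      using x(2) by blast
    show "e \<in> bip_edges {x \<in> V. w x} {x \<in> V. \<not> w x}"
      unfolding bip_edges_def using x e' assms(1,3)[OF x(1)]
      by (cases "w x") blast+
  qed
  moreover have "\<exists>!e. e \<in> involution_edges V f \<and> x \<in> e" if "x \<in> V" for x
  proof
    show "{x, f x} \<in> involution_edges V f \<and> x \<in> {x, f x}"
      using that unfolding involution_edges_def by blast
    show "e = {x, f x}" if "e \<in> involution_edges V f \<and> x \<in> e" for e
      using that assms(2) unfolding involution_edges_def by auto
  qed
  ultimately show ?thesis
    unfolding perfect_matching_Bc_def bisection_def by blast
qed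

text \<open>No counting of sides is required: \<open>f\<close> exchanges them and hence is a
  bijection between them.\<close>

lemma bisection_in_Cset:
  assumes "finite V" "\<And>x. x \<in> V \<Longrightarrow> f x \<in> V" "\<And>x. x \<in> V \<Longrightarrow> f (f x) = x"
    and "\<And>x. x \<in> V \<Longrightarrow> w (f x) \<noteq> w x"
  shows "bisection V w \<in> Cset V"
proof -
  let ?H = "{x \<in> V. w x}" and ?A = "{x \<in> V. \<not> w x}"
  have "bij_betw f ?H ?A"
    by (rule bij_betw_byWitness[where f' = f]) (use assms in auto)
  then have eq: "card ?H = card ?A"
    by (rule bij_betw_same_card)
  have un: "?H \<union> ?A = V"
    by blast
  have "card (?H \<union> ?A) = card ?H + card ?A"
    using assms(1) by (intro card_Un_disjoint) auto
  then have "card ?H = card V div 2" "card ?A = card V div 2"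
    using eq unfolding un by auto
  then show ?thesis
    unfolding Cset_def bisection_def using un by blast
qed

text \<open>Converse passage, from a perfect matching back to a side-changing involution
  \<open>g\<close>.\<close>

lemma perfect_matching_partner:
  assumes "perfect_matching_Bc V (bisection V w) q"
  obtains g where "\<And>x. x \<in> V \<Longrightarrow> {x, g x} \<in> q" "\<And>x. x \<in> V \<Longrightarrow> g x \<in> V"
    "\<And>x. x \<in> V \<Longrightarrow> w (g x) \<noteq> w x" "\<And>x. x \<in> V \<Longrightarrow> g (g x) = x"
proof -
  have uniq: "\<exists>!e. e \<in> q \<and> x \<in> e" if "x \<in> V" for x
    using assms that unfolding perfect_matching_Bc_def by (elim conjE) (rule bspec)
  obtain H A where HA: "bisection V w = {H, A}" "q \<subseteq> bip_edges H A"
    using assms unfolding perfect_matching_Bc_def by (elim conjE exE)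
  have sides: "(H = {x \<in> V. w x} \<and> A = {x \<in> V. \<not> w x}) \<or>
      (H = {x \<in> V. \<not> w x} \<and> A = {x \<in> V. w x})"
    using HA(1) unfolding bisection_def doubleton_eq_iff by metis
  have cut: "\<exists>h a. e = {h, a} \<and> h \<in> V \<and> a \<in> V \<and> w h \<noteq> w a" if e: "e \<in> q" for e
  proof -
    obtain h a where "e = {h, a}" "h \<in> H" "a \<in> A"
      using e HA(2) unfolding bip_edges_def by blast
    then show ?thesis
      using sides by (intro exI[of _ h] exI[of _ a]) auto
  qed
  have "\<exists>y. {x, y} \<in> q \<and> y \<in> V \<and> w y \<noteq> w x" if x: "x \<in> V" for x
  proof -
    obtain e where e: "e \<in> q" "x \<in> e"
      using uniq[OF x] by blast
    obtain h a where ha: "e = {h, a}" "h \<in> V" "a \<in> V" "w h \<noteq> w a"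
      using cut[OF e(1)] by blast
    from e(2) ha(1) have "x = h \<or> x = a"
      by blast
    then show ?thesis
      using e(1) ha by (metis insert_commute)
  qed
  then obtain g where g: "\<And>x. x \<in> V \<Longrightarrow> {x, g x} \<in> q \<and> g x \<in> V \<and> w (g x) \<noteq> w x"
    by metis
  have "g (g x) = x" if x: "x \<in> V" for x
  proof -
    have "{g x, g (g x)} = {x, g x}"
      using uniq[of "g x"] g[OF x] g[of "g x"] by blast
    then show ?thesis
      by (auto simp: doubleton_eq_iff)
  qed
  then show thesis
    using that g by blast
qed

section \<open>Nonnegative integer combinations of generators\<close>

lemma sum_in_Ncomb:
  assumes "finite I" "\<And>i. i \<in> I \<Longrightarrow> m i \<in> M"
  shows "(\<lambda>x. \<Sum>i\<in>I. m i x) \<in> Ncomb M"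
proof -
  \<comment> \<open>\<open>Ncomb\<close> ranges over sets of vectors, so equal terms are grouped and
    the size of each fibre becomes the coefficient.\<close>
  have "(\<Sum>i\<in>I. m i x) = (\<Sum>y\<in>m ` I. card {i \<in> I. m i = y} * y x)" for x
  proof -
    have "(\<Sum>i\<in>I. m i x) = (\<Sum>y\<in>m ` I. \<Sum>i | i \<in> I \<and> m i = y. m i x)"
      by (rule sum.image_gen[OF assms(1)])
    also have "\<dots> = (\<Sum>y\<in>m ` I. \<Sum>i | i \<in> I \<and> m i = y. y x)"
      by (intro sum.cong) auto
    finally show ?thesis
      by simp
  qed
  then show ?thesis
    unfolding Ncomb_def using assms
    by (intro CollectI exI[of _ "m ` I"] exI[of _ "\<lambda>y. card {i \<in> I. m i = y}"]) auto
qed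

text \<open>A positive coordinate at \<open>c\<close> forces some generator over \<open>c\<close> to
  occur with positive coefficient; \<open>q c\<close> is its matching. Generators over different
  partitions are different vectors, so an edge they share is counted at least twice.\<close>

lemma Ncomb_PM_matchings:
  assumes "v \<in> Ncomb (PM V)"
  obtains q where
    "\<And>c. v (Inr c) \<ge> 1 \<Longrightarrow> perfect_matching_Bc V c (q c)"
    "\<And>c e. v (Inr c) \<ge> 1 \<Longrightarrow> e \<in> q c \<Longrightarrow> v (Inl e) \<ge> 1"
    "\<And>c c' e. v (Inr c) \<ge> 1 \<Longrightarrow> v (Inr c') \<ge> 1 \<Longrightarrow> c \<noteq> c' \<Longrightarrow>
      e \<in> q c \<Longrightarrow> e \<in> q c' \<Longrightarrow> v (Inl e) \<ge> 2"
proof -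
  obtain F a where F: "finite F" "F \<subseteq> PM V" and v: "\<And>x. v x = (\<Sum>m\<in>F. a m * m x)"
    using assms unfolding Ncomb_def by blast
  have "\<exists>q. perfect_matching_Bc V c q \<and> chiEc q c \<in> F \<and> a (chiEc q c) \<ge> 1"
    if "v (Inr c) \<ge> 1" for c
  proof -
    have "(\<Sum>m\<in>F. a m * m (Inr c)) \<noteq> 0"
      using that v by (metis not_one_le_zero)
    then obtain m where m: "m \<in> F" "a m * m (Inr c) \<noteq> 0"
      by (meson sum.neutral)
    then obtain q c' where q: "m = chiEc q c'" "perfect_matching_Bc V c' q"
      using F(2) unfolding PM_def by blast
    have "c' = c"
      using m(2) unfolding q(1) chiEc_def by (auto split: if_splits)
    then show ?thesis
      using m q by (metis One_nat_def Suc_leI gr0I mult_0)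
  qed
  then obtain q where q: "\<And>c. v (Inr c) \<ge> 1 \<Longrightarrow>
      perfect_matching_Bc V c (q c) \<and> chiEc (q c) c \<in> F \<and> a (chiEc (q c) c) \<ge> 1"
    by metis
  show thesis
  proof
    show "perfect_matching_Bc V c (q c)" if "v (Inr c) \<ge> 1" for c
      using q[OF that] by blast
    show "v (Inl e) \<ge> 1" if c: "v (Inr c) \<ge> 1" and e: "e \<in> q c" for c e
    proof -
      let ?m = "chiEc (q c) c"
      have "a ?m * ?m (Inl e) \<le> (\<Sum>m\<in>F. a m * m (Inl e))"
        using q[OF c] F(1) by (intro member_le_sum) auto
      moreover have "?m (Inl e) = 1"
        using e by (simp add: chiEc_def)
      ultimately show ?thesis
        using q[OF c] unfolding v by simp
    qed
    show "v (Inl e) \<ge> 2"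
      if c: "v (Inr c) \<ge> 1" "v (Inr c') \<ge> 1" "c \<noteq> c'" and e: "e \<in> q c" "e \<in> q c'" for c c' e
    proof -
      let ?m = "chiEc (q c) c" and ?m' = "chiEc (q c') c'"
      have "?m (Inr c) \<noteq> ?m' (Inr c)"
        using c(3) by (simp add: chiEc_def)
      then have ne: "?m \<noteq> ?m'"
        by metis
      have "(\<Sum>m\<in>{?m, ?m'}. a m * m (Inl e)) \<le> (\<Sum>m\<in>F. a m * m (Inl e))"
        using q[OF c(1)] q[OF c(2)] F(1) by (intro sum_mono2) auto
      moreover have "?m (Inl e) = 1" "?m' (Inl e) = 1"
        using e by (simp_all add: chiEc_def)
      ultimately show ?thesis
        using q[OF c(1)] q[OF c(2)] ne unfolding v by simp
    qed
  qed
qed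

section \<open>Half-integral decompositions of the antiprism\<close>

definition nx :: "nat \<Rightarrow> nat \<Rightarrow> nat" where
  "nx n x = (x + 1) mod n"

text \<open>Adding \<open>n\<close> first avoids truncated subtraction at
  \<open>x = 0\<close>.\<close>

definition pv :: "nat \<Rightarrow> nat \<Rightarrow> nat" where
  "pv n x = (x + n - 1) mod n"

lemma nx_eq: "x < n \<Longrightarrow> nx n x = (if x + 1 = n then 0 else x + 1)"
  unfolding nx_def by auto

lemma pv_eq: "x < n \<Longrightarrow> pv n x = (if x = 0 then n - 1 else x - 1)"
  unfolding pv_def by (auto simp: mod_if)

lemma nx_less: "x < n \<Longrightarrow> nx n x < n"
  by (simp add: nx_eq)

lemma pv_less: "x < n \<Longrightarrow> pv n x < n"
  by (auto simp: pv_eq)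

lemma nx_pv: "x < n \<Longrightarrow> nx n (pv n x) = x"
  using pv_less[of x n] by (auto simp: nx_eq pv_eq split: if_splits)

lemma pv_nx: "x < n \<Longrightarrow> pv n (nx n x) = x"
  using nx_less[of x n] by (auto simp: nx_eq pv_eq split: if_splits)

lemma antiprism_edges_nx:
  "antiprism_edges n = {{i, nx n i} | i. i < n} \<union> {{i, nx n (nx n i)} | i. i < n}"
proof -
  have "nx n (nx n i) = (i + 2) mod n" for i
    unfolding nx_def by (simp add: mod_Suc_eq)
  then show ?thesis
    unfolding antiprism_edges_def by (simp add: nx_def)
qed

text \<open>\<open>w i\<close> is the side indicator of the \<open>i\<close>-th bisection and \<open>d k x\<close> the displacement from
  \<open>x\<close> to its partner in the \<open>k\<close>-th matching; the matchings \<open>2 i\<close> and \<open>2 i + 1\<close> belong to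
  bisection \<open>i\<close>.\<close>

locale half_decomposition =
  fixes n :: nat and w :: "nat \<Rightarrow> nat \<Rightarrow> bool" and d :: "nat \<Rightarrow> nat \<Rightarrow> int"
  assumes n_ge: "n \<ge> 6"
    and d_cases: "k < 8 \<Longrightarrow> x < n \<Longrightarrow> d k x \<in> {1, 2, -1, -2}"
    and d_one: "k < 8 \<Longrightarrow> x < n \<Longrightarrow> d k x = 1 \<longleftrightarrow> d k (nx n x) = -1"
    and d_two: "k < 8 \<Longrightarrow> x < n \<Longrightarrow> d k x = 2 \<longleftrightarrow> d k (nx n (nx n x)) = -2"
    and w_one: "k < 8 \<Longrightarrow> x < n \<Longrightarrow> d k x = 1 \<Longrightarrow> w (k div 2) (nx n x) \<noteq> w (k div 2) x"
    and w_two: "k < 8 \<Longrightarrow> x < n \<Longrightarrow> d k x = 2 \<Longrightarrow> w (k div 2) (nx n (nx n x)) \<noteq> w (k div 2) x"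
    and count_one: "x < n \<Longrightarrow> (\<Sum>k<8. if d k x = 1 then 1 else 0) = (2::nat)"
    and count_two: "x < n \<Longrightarrow> (\<Sum>k<8. if d k x = 2 then 1 else 0) = (2::nat)"
begin

definition partner :: "nat \<Rightarrow> nat \<Rightarrow> nat" where
  "partner k x = (if d k x = 1 then nx n x else if d k x = 2 then nx n (nx n x)
     else if d k x = -1 then pv n x else pv n (pv n x))"

lemma partner_props:
  assumes k: "k < 8" and x: "x < n"
  shows "partner k x < n" "partner k (partner k x) = x"
    "w (k div 2) (partner k x) \<noteq> w (k div 2) x"
proof -
  note less = nx_less[OF x] pv_less[OF x] nx_less[OF nx_less[OF x]] pv_less[OF pv_less[OF x]]
  note inv = nx_pv[OF x] pv_nx[OF x] nx_pv[OF pv_less[OF x]] pv_nx[OF nx_less[OF x]]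
  consider "d k x = 1" | "d k x = 2" | "d k x = -1" | "d k x = -2"
    using d_cases[OF k x] by blast
  then have "partner k x < n \<and> partner k (partner k x) = x \<and>
    w (k div 2) (partner k x) \<noteq> w (k div 2) x"
  proof cases
    case 1
    then show ?thesis
      using d_one[OF k x] w_one[OF k x] less inv by (simp add: partner_def)
  next
    case 2
    then show ?thesis
      using d_two[OF k x] w_two[OF k x] less inv by (simp add: partner_def)
  next
    \<comment> \<open>For negative displacements the locale conditions are applied at the preceding
      vertex, from which \<open>nx\<close> leads back to \<open>x\<close>.\<close>
    case 3
    then show ?thesis
      using d_one[OF k less(2)] w_one[OF k less(2)] less inv by (simp add: partner_def)
  next
    case 4
    then show ?thesis
      using d_two[OF k less(4)] w_two[OF k less(4)] less inv by (simp add: partner_def)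
  qed
  then show "partner k x < n" "partner k (partner k x) = x"
    "w (k div 2) (partner k x) \<noteq> w (k div 2) x"
    by blast+
qed

text \<open>Since \<open>n \<ge> 6\<close>, the two forward neighbours differ from each other and
  from the backward ones, so the partner determines the displacement.\<close>

lemma partner_eq_nx:
  assumes k: "k < 8" and x: "x < n"
  shows "partner k x = nx n x \<longleftrightarrow> d k x = 1" "partner k x = nx n (nx n x) \<longleftrightarrow> d k x = 2"
proof -
  note less = nx_less[OF x] pv_less[OF x]
  have "nx n x \<noteq> nx n (nx n x)" "nx n x \<noteq> pv n x" "nx n x \<noteq> pv n (pv n x)"
    "nx n (nx n x) \<noteq> pv n x" "nx n (nx n x) \<noteq> pv n (pv n x)"
    using less n_ge x by (auto simp: nx_eq pv_eq split: if_splits)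
  then show "partner k x = nx n x \<longleftrightarrow> d k x = 1" "partner k x = nx n (nx n x) \<longleftrightarrow> d k x = 2"
    using d_cases[OF k x] by (auto simp: partner_def)
qed

section \<open>The half-integral vector\<close>

abbreviation part :: "nat \<Rightarrow> nat set set" where
  "part i \<equiv> bisection {0..<n} (w i)"

abbreviation matching :: "nat \<Rightarrow> nat set set" where
  "matching k \<equiv> involution_edges {0..<n} (partner k)"

definition target :: "nat vec" where
  "target = (\<lambda>x. case x of Inl e \<Rightarrow> (if e \<in> antiprism_edges n then 1 else 0)
    | Inr c \<Rightarrow> (\<Sum>i<4. if c = part i then 1 else 0))"

lemma part_in_Cset:
  assumes "i < 4"
  shows "part i \<in> Cset {0..<n}"
  \<comment> \<open>Matching \<open>2 * i\<close>, which belongs to bisection \<open>i\<close>,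
    certifies that the sides have equal size.\<close>
  using partner_props[of "2 * i"] assms by (intro bisection_in_Cset[where f = "partner (2 * i)"]) auto

lemma matching_perfect:
  assumes "k < 8"
  shows "perfect_matching_Bc {0..<n} (part (k div 2)) (matching k)"
  using partner_props[OF assms] by (intro perfect_matching_involution_edges) auto

lemma in_matching_iff:
  assumes "k < 8" "x < n"
  shows "{x, y} \<in> matching k \<longleftrightarrow> partner k x = y"
  using partner_props[OF assms(1)] assms(2) by (intro doubleton_in_involution_edges) auto

lemma matching_subset:
  assumes k: "k < 8"
  shows "matching k \<subseteq> antiprism_edges n"
proof
  fix e assume "e \<in> matching k"
  then obtain x where x: "x < n" "e = {x, partner k x}"
    unfolding involution_edges_def by auto
  note less = pv_less[OF x(1)] pv_less[OF pv_less[OF x(1)]]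
  note inv = nx_pv[OF x(1)] nx_pv[OF pv_less[OF x(1)]]
  have "e = {partner k x, x}"
    using x(2) by blast
  then show "e \<in> antiprism_edges n"
    using x less inv d_cases[OF k x(1)] unfolding antiprism_edges_nx partner_def
    by (smt (verit, best) UnI1 UnI2 mem_Collect_eq)
qed

text \<open>Read from its rear endpoint \<open>i\<close>, an edge lies in matching \<open>k\<close>
  exactly when \<open>d k i\<close> is its length 1 or 2; \<open>count_one\<close> and
  \<open>count_two\<close> then apply.\<close>

lemma matching_cover:
  "(\<Sum>k<8. if e \<in> matching k then 1 else 0) = (if e \<in> antiprism_edges n then 2 else (0::nat))"
proof (cases "e \<in> antiprism_edges n")
  case True
  then obtain i where i: "i < n" "e = {i, nx n i} \<or> e = {i, nx n (nx n i)}"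
    unfolding antiprism_edges_nx by blast
  from i(2) show ?thesis
  proof
    assume "e = {i, nx n i}"
    then have "(\<Sum>k<8. if e \<in> matching k then 1 else 0) = (\<Sum>k<8. if d k i = 1 then 1 else (0::nat))"
      using in_matching_iff[OF _ i(1)] partner_eq_nx[OF _ i(1)] by (intro sum.cong) auto
    then show ?thesis
      using True count_one[OF i(1)] by simp
  next
    assume "e = {i, nx n (nx n i)}"
    then have "(\<Sum>k<8. if e \<in> matching k then 1 else 0) = (\<Sum>k<8. if d k i = 2 then 1 else (0::nat))"
      using in_matching_iff[OF _ i(1)] partner_eq_nx[OF _ i(1)] by (intro sum.cong) auto
    then show ?thesis
      using True count_two[OF i(1)] by simp
  qed
next
  case False
  then have "(\<Sum>k<8. if e \<in> matching k then 1 else 0) = (\<Sum>k<8::nat. 0::nat)"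
    using matching_subset by (intro sum.cong) auto
  then show ?thesis
    using False by simp
qed

lemma antiprism_edges_subset_Kset: "antiprism_edges n \<subseteq> Kset {0..<n}"
proof
  fix e assume "e \<in> antiprism_edges n"
  then obtain i where i: "i < n" "e = {i, nx n i} \<or> e = {i, nx n (nx n i)}"
    unfolding antiprism_edges_nx by blast
  have "nx n i \<noteq> i" "nx n (nx n i) \<noteq> i"
    using i(1) nx_less[OF i(1)] n_ge by (auto simp: nx_eq split: if_splits)
  then show "e \<in> Kset {0..<n}"
    unfolding Kset_def using i nx_less[OF i(1)] nx_less[OF nx_less[OF i(1)]] by auto
qed

text \<open>The multiplier is 2: the eight matchings cover each edge twice, and
  \<open>k div 2\<close> takes each value below 4 twice.\<close>

lemma target_in_Nbar: "target \<in> Nbar {0..<n} (PM {0..<n})"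
proof -
  have "target \<in> vecs {0..<n}"
    unfolding vecs_def coords_def target_def
    using antiprism_edges_subset_Kset part_in_Cset by (auto split: sum.split intro!: sum.neutral)
  moreover have "(\<lambda>x. 2 * target x) = (\<lambda>x. \<Sum>k<8. chiEc (matching k) (part (k div 2)) x)"
  proof
    fix x
    show "2 * target x = (\<Sum>k<8. chiEc (matching k) (part (k div 2)) x)"
    proof (cases x)
      case (Inl e)
      then show ?thesis
        using matching_cover[of e] by (simp add: target_def chiEc_def)
    next
      case (Inr c)
      then show ?thesis
        by (simp add: target_def chiEc_def lessThan_nat_numeral lessThan_Suc)
    qed
  qed
  moreover have "(\<lambda>x. \<Sum>k<8. chiEc (matching k) (part (k div 2)) x) \<in> Ncomb (PM {0..<n})"
  proof (rule sum_in_Ncomb)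
    show "chiEc (matching k) (part (k div 2)) \<in> PM {0..<n}" if "k \<in> {..<8}" for k
    proof -
      have "k < 8" "k div 2 < 4"
        using that by auto
      then show ?thesis
        using matching_perfect part_in_Cset unfolding PM_def by blast
    qed
  qed simp
  ultimately show ?thesis
    unfolding Nbar_def by (auto intro!: exI[of _ 2])
qed

text \<open>The edge coordinates of \<open>target\<close> are 1 on the antiprism and 0 elsewhere, so
  an integral decomposition yields matchings inside the antiprism that are edge-disjoint for
  different partitions. A pair of vertices together in one bisection and separated in the other
  shows two partitions to be different.\<close>

lemma B_factorizable_partners:
  assumes "B_factorizable {0..<n} (antiprism_edges n)"
    and distinct: "\<And>i j. i < 4 \<Longrightarrow> j < i \<Longrightarrow> \<exists>x<n. \<exists>y<n. (w i x = w i y) \<noteq> (w j x = w j y)"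
  obtains g where
    "\<And>i x. i < 4 \<Longrightarrow> x < n \<Longrightarrow> g i x < n \<and> g i (g i x) = x \<and> w i (g i x) \<noteq> w i x"
    "\<And>i x. i < 4 \<Longrightarrow> x < n \<Longrightarrow> g i x \<in> {nx n x, nx n (nx n x), pv n x, pv n (pv n x)}"
    "\<And>i j x. i < 4 \<Longrightarrow> j < 4 \<Longrightarrow> i \<noteq> j \<Longrightarrow> x < n \<Longrightarrow> g i x \<noteq> g j x"
proof -
  have "restrK_eq {0..<n} target (antiprism_edges n)"
    unfolding restrK_eq_def target_def by simp
  then have "target \<in> Ncomb (PM {0..<n})"
    using assms(1) target_in_Nbar unfolding B_factorizable_def by blast
  then obtain q where q:
    "\<And>c. target (Inr c) \<ge> 1 \<Longrightarrow> perfect_matching_Bc {0..<n} c (q c)"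
    "\<And>c e. target (Inr c) \<ge> 1 \<Longrightarrow> e \<in> q c \<Longrightarrow> target (Inl e) \<ge> 1"
    "\<And>c c' e. target (Inr c) \<ge> 1 \<Longrightarrow> target (Inr c') \<ge> 1 \<Longrightarrow> c \<noteq> c' \<Longrightarrow>
      e \<in> q c \<Longrightarrow> e \<in> q c' \<Longrightarrow> target (Inl e) \<ge> 2"
    by (rule Ncomb_PM_matchings) blast
  have target_part: "target (Inr (part i)) \<ge> 1" if "i < 4" for i
  proof -
    have "(if part i = part i then 1 else 0) \<le> (\<Sum>j<4. if part i = part j then 1 else (0::nat))"
      using that by (intro member_le_sum) auto
    then show ?thesis
      by (simp add: target_def)
  qed
  have part_less: "part i \<noteq> part j" if ij: "i < 4" "j < i" for i j
    using distinct[OF ij] bisection_eqD[of "{0..<n}" "w i" "w j"] by fastforce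
  have part_neq: "part i \<noteq> part j" if "i < 4" "j < 4" "i \<noteq> j" for i j
    using part_less[of i j] part_less[of j i] that by (metis nat_neq_iff)
  have "\<exists>g. \<forall>x<n. {x, g x} \<in> q (part i) \<and> g x < n \<and> g (g x) = x \<and> w i (g x) \<noteq> w i x" if "i < 4" for i
    using perfect_matching_partner[OF q(1)[OF target_part[OF that]]]
    by (metis atLeastLessThan_iff zero_le)
  then obtain g where g: "\<And>i x. i < 4 \<Longrightarrow> x < n \<Longrightarrow>
      {x, g i x} \<in> q (part i) \<and> g i x < n \<and> g i (g i x) = x \<and> w i (g i x) \<noteq> w i x"
    by metis
  show thesis
  proof
    show "g i x < n \<and> g i (g i x) = x \<and> w i (g i x) \<noteq> w i x" if "i < 4" "x < n" for i x
      using g[OF that] by blast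
    show "g i x \<in> {nx n x, nx n (nx n x), pv n x, pv n (pv n x)}" if i: "i < 4" and x: "x < n" for i x
    proof -
      have "target (Inl {x, g i x}) \<ge> 1"
        using q(2)[OF target_part[OF i]] g[OF i x] by blast
      then have "{x, g i x} \<in> antiprism_edges n"
        by (simp add: target_def split: if_splits)
      then obtain y where y: "y < n" "{x, g i x} = {y, nx n y} \<or> {x, g i x} = {y, nx n (nx n y)}"
        unfolding antiprism_edges_nx by blast
      then show ?thesis
        using pv_nx[OF y(1)] pv_nx[OF nx_less[OF y(1)]] unfolding doubleton_eq_iff by auto
    qed
    show "g i x \<noteq> g j x" if ij: "i < 4" "j < 4" "i \<noteq> j" and x: "x < n" for i j x
    proof
      assume "g i x = g j x"
      then have "target (Inl {x, g i x}) \<ge> 2"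
        using q(3)[OF target_part[OF ij(1)] target_part[OF ij(2)] part_neq[OF ij]]
          g[OF ij(1) x] g[OF ij(2) x] by metis
      then show False
        by (simp add: target_def split: if_splits)
    qed
  qed
qed

end

section \<open>Periodic tables\<close>

text \<open>For \<open>n = n0 + 4 t\<close> the data at a vertex \<open>x\<close> are read off column \<open>column n0 x\<close> of a table
  with \<open>n0 + 4\<close> columns, the last four of which are repeated \<open>t\<close> times. Hence the columns of two
  cyclically consecutive vertices are related by \<open>column_steps n0\<close>, and the conditions of
  \<open>half_decomposition\<close> become a finite check that does not depend on \<open>t\<close>.\<close>

definition column :: "nat \<Rightarrow> nat \<Rightarrow> nat" where
  "column n0 x = (if x < n0 then x else n0 + (x - n0) mod 4)"

text \<open>The first pair is the wrap-around for \<open>t = 0\<close>, the second the passage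
  between copies of the block, the third the wrap-around after the last copy.\<close>

definition column_steps :: "nat \<Rightarrow> (nat \<times> nat) list" where
  "column_steps n0 = (n0 - 1, 0) # (n0 + 3, n0) # (n0 + 3, 0) # map (\<lambda>a. (a, a + 1)) [0..<n0 + 3]"

text \<open>All quantifiers run over explicit lists so that the condition can be evaluated.
  Displacement 2 is tested on pairs of steps with a common middle column.\<close>

definition valid_table :: "nat \<Rightarrow> nat list list \<Rightarrow> int list list \<Rightarrow> bool" where
  "valid_table n0 W D \<longleftrightarrow>
    (\<forall>k\<in>set [0..<8]. \<forall>a\<in>set [0..<n0 + 4]. D ! k ! a \<in> set [1, 2, -1, -2]) \<and>
    (\<forall>(a, b)\<in>set (column_steps n0). \<forall>k\<in>set [0..<8].
      (D ! k ! a = 1 \<longleftrightarrow> D ! k ! b = -1) \<and>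
      (D ! k ! a = 1 \<longrightarrow> (W ! (k div 2) ! b = 1) \<noteq> (W ! (k div 2) ! a = 1))) \<and>
    (\<forall>(a, b)\<in>set (column_steps n0). \<forall>(b', c)\<in>set (column_steps n0). b' = b \<longrightarrow>
      (\<forall>k\<in>set [0..<8].
        (D ! k ! a = 2 \<longleftrightarrow> D ! k ! c = -2) \<and>
        (D ! k ! a = 2 \<longrightarrow> (W ! (k div 2) ! c = 1) \<noteq> (W ! (k div 2) ! a = 1)))) \<and>
    (\<forall>a\<in>set [0..<n0 + 4].
      sum_list (map (\<lambda>k. if D ! k ! a = 1 then 1 else 0) [0..<8]) = (2::nat) \<and>
      sum_list (map (\<lambda>k. if D ! k ! a = 2 then 1 else 0) [0..<8]) = (2::nat)) \<and>
    (\<forall>i\<in>set [0..<4]. \<forall>j\<in>set [0..<i]. \<exists>x\<in>set [0..<n0]. \<exists>y\<in>set [0..<n0].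
      ((W ! i ! x = 1) = (W ! i ! y = 1)) \<noteq> ((W ! j ! x = 1) = (W ! j ! y = 1)))"

lemma column_less: "column n0 x < n0 + 4"
  by (simp add: column_def)

lemma column_step:
  assumes "n = n0 + 4 * t" "n0 > 0" "x < n"
  shows "(column n0 x, column n0 (nx n x)) \<in> set (column_steps n0)"
proof (cases "x < n0")
  case True
  then show ?thesis
    using assms by (auto simp: column_def column_steps_def nx_eq)
next
  case False
  then obtain y where y: "x = n0 + y"
    by (metis le_Suc_ex not_less)
  have "y < 4 * t"
    using assms y by simp
  have "(Suc y mod 4 = 0 \<and> y mod 4 = 3) \<or> (Suc y mod 4 = Suc (y mod 4) \<and> y mod 4 < 3)"
    by presburger
  \<comment> \<open>The last vertex ends a block, so its wrap-around is the pair
    \<open>(n0 + 3, 0)\<close>.\<close>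
  moreover have "y mod 4 = 3" if "Suc y = 4 * t"
    using that by presburger
  ultimately show ?thesis
    using assms y by (auto simp: column_def column_steps_def nx_eq)
qed

lemma valid_table_half_decomposition:
  assumes valid: "valid_table n0 W D" and n: "n = n0 + 4 * t" "n0 \<ge> 6"
  shows "half_decomposition n (\<lambda>i x. W ! i ! column n0 x = 1) (\<lambda>k x. D ! k ! column n0 x)"
proof -
  have step: "(column n0 x, column n0 (nx n x)) \<in> set (column_steps n0)" if "x < n" for x
    using column_step[OF n(1) _ that] n(2) by simp
  note col = column_less[of n0]
  note tests = valid[unfolded valid_table_def]
  note test_one = tests[THEN conjunct2, THEN conjunct1]
  note test_two = tests[THEN conjunct2, THEN conjunct2, THEN conjunct1]
  note test_count = tests[THEN conjunct2, THEN conjunct2, THEN conjunct2, THEN conjunct1]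
  have one: "(D ! k ! column n0 x = 1 \<longleftrightarrow> D ! k ! column n0 (nx n x) = -1) \<and>
      (D ! k ! column n0 x = 1 \<longrightarrow>
        (W ! (k div 2) ! column n0 (nx n x) = 1) \<noteq> (W ! (k div 2) ! column n0 x = 1))"
    if "k < 8" "x < n" for k x
    by (rule bspec[OF bspec[OF test_one step[OF that(2)], unfolded prod.case]]) (use that(1) in simp)
  have two: "(D ! k ! column n0 x = 2 \<longleftrightarrow> D ! k ! column n0 (nx n (nx n x)) = -2) \<and>
      (D ! k ! column n0 x = 2 \<longrightarrow>
        (W ! (k div 2) ! column n0 (nx n (nx n x)) = 1) \<noteq> (W ! (k div 2) ! column n0 x = 1))"
    if "k < 8" "x < n" for k x
    by (rule bspec[OF bspec[OF test_two step[OF that(2)], unfolded prod.case]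
            step[OF nx_less[OF that(2)]], unfolded prod.case, rule_format])
      (use that(1) in simp_all)
  have cases: "D ! k ! column n0 x \<in> {1, 2, -1, -2}" if "k < 8" for k x
    using bspec[OF bspec[OF tests[THEN conjunct1]], of k "column n0 x"] that col[of x] by simp
  have count: "(\<Sum>k<8. if D ! k ! column n0 x = 1 then 1 else 0) = (2::nat)"
    "(\<Sum>k<8. if D ! k ! column n0 x = 2 then 1 else 0) = (2::nat)" for x
    using bspec[OF test_count, of "column n0 x"] col[of x]
    by (simp_all add: interv_sum_list_conv_sum_set_nat atLeast0LessThan)
  show ?thesis
  proof unfold_locales
    show "6 \<le> n"
      using n by linarith
  qed (use cases one two count in metis)+
qed

lemma valid_table_partners:
  assumes valid: "valid_table n0 W D" and n: "n = n0 + 4 * t" "n0 \<ge> 6"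
    and "B_factorizable {0..<n} (antiprism_edges n)"
  obtains g where
    "\<And>i x. i < 4 \<Longrightarrow> x < n \<Longrightarrow> g i (g i x) = x"
    "\<And>i x. i < 4 \<Longrightarrow> x < n \<Longrightarrow> (W ! i ! column n0 (g i x) = 1) \<noteq> (W ! i ! column n0 x = 1)"
    "\<And>i x. i < 4 \<Longrightarrow> x < n \<Longrightarrow> g i x \<in> {nx n x, nx n (nx n x), pv n x, pv n (pv n x)}"
    "\<And>i j x. i < 4 \<Longrightarrow> j < 4 \<Longrightarrow> i \<noteq> j \<Longrightarrow> x < n \<Longrightarrow> g i x \<noteq> g j x"
proof -
  interpret half_decomposition n "\<lambda>i x. W ! i ! column n0 x = 1" "\<lambda>k x. D ! k ! column n0 x"
    by (rule valid_table_half_decomposition[OF valid n])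
  have "\<exists>x<n. \<exists>y<n. ((W ! i ! column n0 x = 1) = (W ! i ! column n0 y = 1)) \<noteq>
      ((W ! j ! column n0 x = 1) = (W ! j ! column n0 y = 1))" if "i < 4" "j < i" for i j
  proof -
    have "\<exists>x\<in>set [0..<n0]. \<exists>y\<in>set [0..<n0].
        ((W ! i ! x = 1) = (W ! i ! y = 1)) \<noteq> ((W ! j ! x = 1) = (W ! j ! y = 1))"
      by (rule bspec[OF bspec[OF valid[unfolded valid_table_def, THEN conjunct2, THEN conjunct2,
              THEN conjunct2, THEN conjunct2]]]) (use that in simp_all)
    then obtain x y where xy: "x \<in> set [0..<n0]" "y \<in> set [0..<n0]"
      "((W ! i ! x = 1) = (W ! i ! y = 1)) \<noteq> ((W ! j ! x = 1) = (W ! j ! y = 1))"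
      by (elim bexE)
    show ?thesis
      by (rule exI[of _ x], rule conjI, use xy n in simp, rule exI[of _ y])
        (use xy n in \<open>simp add: column_def\<close>)
  qed
  then show thesis
    by (rule B_factorizable_partners[OF assms(4)]) (use that in blast)+
qed

text \<open>The tables were found by a computer search.\<close>

definition words6 :: "nat list list" where
  "words6 =
    [[0,0,0,1,1,1, 0,0,1,1],
     [0,1,0,1,1,0, 0,1,1,0],
     [0,0,1,1,0,1, 0,1,0,1],
     [0,1,1,1,0,0, 0,1,1,0]]"

text \<open>Rows \<open>2 * i\<close> and \<open>2 * i + 1\<close> go with row \<open>i\<close> of
  \<open>words6\<close>; the repeated columns follow the wider gap.\<close>

definition displacements6 :: "int list list" where
  "displacements6 =
    [[-2,-2,1,-1,2,2, -2,-2,2,2],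
     [-1,2,2,-2,-2,1, -1,1,-1,1],
     [1,-1,1,-1,1,-1, 1,-1,1,-1],
     [-2,1,-1,2,2,-2, -2,2,2,-2],
     [-1,1,-1,1,-1,1, -1,1,-1,1],
     [2,2,-2,-2,1,-1, 1,-1,1,-1],
     [2,-2,-2,1,-1,2, 2,-2,-2,2],
     [1,-1,2,2,-2,-2, 2,2,-2,-2]]"

definition words8 :: "nat list list" where
  "words8 =
    [[1,0,0,1,1,1,0,0, 1,0,1,0],
     [0,1,0,1,1,0,0,1, 0,1,0,1],
     [1,0,0,1,0,1,0,1, 1,0,0,1],
     [1,0,1,1,0,0,0,1, 1,0,0,1]]"

definition displacements8 :: "int list list" where
  "displacements8 =
    [[1,-1,1,-1,2,2,-2,-2, 1,-1,1,-1],
     [-1,2,2,-2,-2,1,-1,1, -1,1,-1,1],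
     [1,-1,1,-1,1,-1,1,-1, 1,-1,1,-1],
     [-1,1,-1,2,2,-2,-2,1, -1,1,-1,1],
     [2,-2,-2,1,-1,1,-1,2, 2,-2,-2,2],
     [2,2,-2,-2,1,-1,1,-1, 2,2,-2,-2],
     [-2,1,-1,1,-1,2,2,-2, -2,2,2,-2],
     [-2,-2,2,2,-2,-2,2,2, -2,-2,2,2]]"

lemma valid_table6: "valid_table 6 words6 displacements6"
  by code_simp

lemma valid_table8: "valid_table 8 words8 displacements8"
  by code_simp

section \<open>The obstructions\<close>

lemma not_B_factorizable6:
  assumes n: "n = 6 + 4 * t"
  shows "\<not> B_factorizable {0..<n} (antiprism_edges n)"
proof
  assume "B_factorizable {0..<n} (antiprism_edges n)"
  from valid_table_partners[OF valid_table6 n order.refl this] obtain g where g: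
    "\<And>i x. i < 4 \<Longrightarrow> x < n \<Longrightarrow> g i (g i x) = x"
    "\<And>i x. i < 4 \<Longrightarrow> x < n \<Longrightarrow>
      (words6 ! i ! column 6 (g i x) = 1) \<noteq> (words6 ! i ! column 6 x = 1)"
    "\<And>i x. i < 4 \<Longrightarrow> x < n \<Longrightarrow> g i x \<in> {nx n x, nx n (nx n x), pv n x, pv n (pv n x)}"
    "\<And>i j x. i < 4 \<Longrightarrow> j < 4 \<Longrightarrow> i \<noteq> j \<Longrightarrow> x < n \<Longrightarrow> g i x \<noteq> g j x"
    by blast
  \<comment> \<open>\<open>z\<close> is the vertex \<open>0\<close> if \<open>n = 6\<close> and \<open>6\<close> otherwise; the words agree in these two columns.\<close>
  define z where "z = nx n 5"
  have z: "column 6 z \<in> {0, 6}"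
    using n by (auto simp: z_def nx_eq column_def)
  have nb: "g i 2 \<in> {0, 1, 3, 4}" "g i 3 \<in> {1, 2, 4, 5}" "g i 4 \<in> {2, 3, 5, z}" if "i < 4" for i
    using g(3)[OF that, of 2] g(3)[OF that, of 3] g(3)[OF that, of 4] n
    by (auto simp: nx_eq pv_eq z_def)
  note flip = g(2)[of _ 2] g(2)[of _ 3] g(2)[of _ 4]
  have g0: "g 0 2 \<in> {3, 4}" "g 0 3 \<in> {1, 2}" "g 0 4 \<in> {2, z}"
    using nb[of 0] flip[of 0] n by (auto simp: words6_def column_def)
  have g1: "g 1 2 \<in> {1, 3, 4}" "g 1 3 \<in> {2, 5}" "g 1 4 \<in> {2, 5, z}"
    using nb[of 1] flip[of 1] n by (auto simp: words6_def column_def)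
  have g2: "g 2 2 \<in> {0, 1, 4}" "g 2 3 \<in> {1, 4}" "g 2 4 \<in> {2, 3, 5}"
    using nb[of 2] flip[of 2] n z by (auto simp: words6_def column_def)
  have g3: "g 3 2 \<in> {0, 4}" "g 3 3 \<in> {4, 5}" "g 3 4 \<in> {2, 3}"
    using nb[of 3] flip[of 3] n z by (auto simp: words6_def column_def)
  have inv: "g i (g i 2) = 2" "g i (g i 3) = 3" "g i (g i 4) = 4" if "i < 4" for i
    using g(1)[OF that] n by simp_all
  have d: "g 0 x \<noteq> g 1 x" "g 0 x \<noteq> g 2 x" "g 0 x \<noteq> g 3 x" "g 1 x \<noteq> g 2 x" "g 1 x \<noteq> g 3 x"
      "g 2 x \<noteq> g 3 x" if "x \<in> {2, 3, 4}" for x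
    by (rule g(4); use that n in force)+
  \<comment> \<open>At vertex 3 the values of \<open>g 0\<close>, \<open>g 1\<close>,
    \<open>g 2\<close>, \<open>g 3\<close> can only be 1, 2, 4, 5 or 2, 5, 1, 4 in this order.
    Either choice contradicts the lists at 2 and 4 together with involutivity.\<close>
  show False
    using g0 g1 g2 g3 inv[of 0] inv[of 1] inv[of 2] inv[of 3] d[of 2] d[of 3] d[of 4]
    by simp (smt (verit) numeral_eq_iff num.distinct num.inject zero_neq_numeral numeral_eq_one_iff)
qed

text \<open>The neighbours of the vertices 2 to 5 all lie below 8, so the inserted columns do not
  affect the argument.\<close>

lemma not_B_factorizable8:
  assumes n: "n = 8 + 4 * t"
  shows "\<not> B_factorizable {0..<n} (antiprism_edges n)"
proof
  assume "B_factorizable {0..<n} (antiprism_edges n)"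
  from valid_table_partners[OF valid_table8 n _ this] obtain g where g:
    "\<And>i x. i < 4 \<Longrightarrow> x < n \<Longrightarrow> g i (g i x) = x"
    "\<And>i x. i < 4 \<Longrightarrow> x < n \<Longrightarrow>
      (words8 ! i ! column 8 (g i x) = 1) \<noteq> (words8 ! i ! column 8 x = 1)"
    "\<And>i x. i < 4 \<Longrightarrow> x < n \<Longrightarrow> g i x \<in> {nx n x, nx n (nx n x), pv n x, pv n (pv n x)}"
    "\<And>i j x. i < 4 \<Longrightarrow> j < 4 \<Longrightarrow> i \<noteq> j \<Longrightarrow> x < n \<Longrightarrow> g i x \<noteq> g j x"
    by (simp, blast)
  have nb: "g i 2 \<in> {0, 1, 3, 4}" "g i 3 \<in> {1, 2, 4, 5}" "g i 4 \<in> {2, 3, 5, 6}"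
      "g i 5 \<in> {3, 4, 6, 7}" if "i < 4" for i
    using g(3)[OF that, of 2] g(3)[OF that, of 3] g(3)[OF that, of 4] g(3)[OF that, of 5] n
    by (auto simp: nx_eq pv_eq)
  \<comment> \<open>Stated with \<open>filter\<close> so that simplification computes the neighbours
    across the cut.\<close>
  have cut: "g i x \<in> set (filter (\<lambda>y. (words8 ! i ! y = 1) \<noteq> (words8 ! i ! x = 1)) ys)"
    if "i < 4" "x < 8" "set ys \<subseteq> {..<8}" "g i x \<in> set ys" for i x ys
    using g(2)[OF that(1), of x] that n by (auto simp: column_def)
  note cuts = cut[of _ 2 "[0, 1, 3, 4]"] cut[of _ 3 "[1, 2, 4, 5]"]
    cut[of _ 4 "[2, 3, 5, 6]"] cut[of _ 5 "[3, 4, 6, 7]"]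
  have g0: "g 0 2 \<in> {0, 3, 4}" "g 0 3 \<in> {1, 2}" "g 0 4 \<in> {2, 6}" "g 0 5 \<in> {6, 7}"
    using nb[of 0] cuts[of 0] by (simp_all add: words8_def)
  have g1: "g 1 2 \<in> {1, 3, 4}" "g 1 3 \<in> {2, 5}" "g 1 4 \<in> {2, 5, 6}" "g 1 5 \<in> {3, 4, 7}"
    using nb[of 1] cuts[of 1] by (simp_all add: words8_def)
  have g2: "g 2 2 \<in> {0, 3}" "g 2 3 \<in> {1, 2, 4}" "g 2 4 \<in> {3, 5}" "g 2 5 \<in> {4, 6}"
    using nb[of 2] cuts[of 2] by (simp_all add: words8_def)
  have g3: "g 3 2 \<in> {1, 4}" "g 3 3 \<in> {1, 4, 5}" "g 3 4 \<in> {2, 3}" "g 3 5 \<in> {3, 7}"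
    using nb[of 3] cuts[of 3] by (simp_all add: words8_def)
  have inv: "g i (g i 2) = 2" "g i (g i 3) = 3" "g i (g i 4) = 4" "g i (g i 5) = 5" if "i < 4" for i
    using g(1)[OF that] n by simp_all
  have d: "g 0 x \<noteq> g 1 x" "g 0 x \<noteq> g 2 x" "g 0 x \<noteq> g 3 x" "g 1 x \<noteq> g 2 x" "g 1 x \<noteq> g 3 x"
      "g 2 x \<noteq> g 3 x" if "x \<in> {2, 3, 4, 5}" for x
    by (rule g(4); use that n in force)+
  \<comment> \<open>All four neighbours of 3 are used, and only \<open>g 2\<close> or
    \<open>g 3\<close> can join 3 to 4. Either choice forces the other values until vertex 2 is left
    with an inadmissible one: 1 for \<open>g 0\<close> in the first case, 0 for \<open>g 1\<close>
    in the second.\<close>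
  show False
    using g0 g1 g2 g3 inv[of 0] inv[of 1] inv[of 2] inv[of 3] d[of 2] d[of 3] d[of 4] d[of 5]
    by simp (smt (verit) numeral_eq_iff num.distinct num.inject zero_neq_numeral numeral_eq_one_iff)
qed

theorem mainTheorem10:
  fixes n :: nat
  assumes "even n" and "n \<ge> 6"
  shows "\<not> B_factorizable {0..<n} (antiprism_edges n)"
proof -
  \<comment> \<open>The two tables serve the residues 2 and 0 modulo 4.\<close>
  have "\<exists>t. n = 6 + 4 * t \<or> n = 8 + 4 * t"
    using assms by presburger
  then show ?thesis
    using not_B_factorizable6 not_B_factorizable8 by blast
qed

end
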